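(* Let $X$ be a stiff interval space. Then for each convex set $A\subseteq X$, the binary relation $\langle A,\cdot,\cdot\rangle$ is antisymmetric on $X\setminus A$; that is, for $b,c\in X\setminus A$, $\langle A,b,c\rangle$ and $\langle A,c,b\rangle$ imply $b=c$.
   Context: An interval space is a set $X$ with a ternary relation $\langle\cdot,\cdot,\cdot\rangle$ such that: $\langle x,x,a\rangle$ and $\langle a,x,x\rangle$ for all $a,x\in X$; $\langle x,a,z\rangle\Rightarrow\langle z,a,x\rangle$; and $\langle x,y,x\rangle$ implies $y=x$. It is stiff iff for all $a,b,c,d\in X$, ($\langle a,b,c\rangle$ and $b\neq c$ and $\langle b,c,d\rangle$) implies $\langle a,b,d\rangle$. For $A\subseteq X$ and $b,c\in X$, $\langle A,b,c\rangle$ means there is $a\in A$ with $\langle a,b,c\rangle$. A set $C\subseteq X$ is convex iff for all $x,y,z\in X$, $\langle x,y,z\rangle$ and $x,z\in C$ imply $y\in C$. *)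

theory Defs
  imports Main
begin

text \<open>The carrier \<open>X\<close> is an explicit set; values of the relation \<open>I\<close> outside \<open>X\<close> are irrelevant.
  \<open>I a b c\<close> reads as \<open>\<langle>a, b, c\<rangle>\<close>.\<close>

locale interval_space =
  fixes X :: "'a set" and I :: "'a \<Rightarrow> 'a \<Rightarrow> 'a \<Rightarrow> bool"
  assumes left_refl: "\<lbrakk>a \<in> X; x \<in> X\<rbrakk> \<Longrightarrow> I x x a"
    and right_refl: "\<lbrakk>a \<in> X; x \<in> X\<rbrakk> \<Longrightarrow> I a x x"
    and symm: "\<lbrakk>x \<in> X; a \<in> X; z \<in> X; I x a z\<rbrakk> \<Longrightarrow> I z a x"
    and degenerate: "\<lbrakk>x \<in> X; y \<in> X; I x y x\<rbrakk> \<Longrightarrow> y = x"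

locale stiff_interval_space = interval_space +
  assumes stiff: "\<lbrakk>a \<in> X; b \<in> X; c \<in> X; d \<in> X; I a b c; b \<noteq> c; I b c d\<rbrakk> \<Longrightarrow> I a b d"

definition interval_convex :: "'a set \<Rightarrow> ('a \<Rightarrow> 'a \<Rightarrow> 'a \<Rightarrow> bool) \<Rightarrow> 'a set \<Rightarrow> bool" where
  "interval_convex X I C \<longleftrightarrow>
    C \<subseteq> X \<and> (\<forall>x\<in>X. \<forall>y\<in>X. \<forall>z\<in>X. I x y z \<and> x \<in> C \<and> z \<in> C \<longrightarrow> y \<in> C)"

definition set_between :: "('a \<Rightarrow> 'a \<Rightarrow> 'a \<Rightarrow> bool) \<Rightarrow> 'a set \<Rightarrow> 'a \<Rightarrow> 'a \<Rightarrow> bool" where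
  "set_between I A b c \<longleftrightarrow> (\<exists>a\<in>A. I a b c)"

end

theory Submission
  imports Defs
begin

text \<open>Two distinct points outside \<open>A\<close>, each lying between \<open>A\<close> and
  the other, would form a chain that starts and ends in \<open>A\<close>. Stiffness glues the two
  betweenness relations along the pair \<open>b\<close>, \<open>c\<close>, so \<open>b\<close> lies
  between two points of \<open>A\<close>, and convexity forces \<open>b\<close> into
  \<open>A\<close>.\<close>

theorem proposition3p2:
  fixes X :: "'a set" and I :: "'a \<Rightarrow> 'a \<Rightarrow> 'a \<Rightarrow> bool" and A :: "'a set"
  assumes "stiff_interval_space X I"
    and "A \<subseteq> X"
    and "interval_convex X I A"
  shows "antisymp_on (X - A) (set_between I A)"
proof (rule antisymp_onI, rule ccontr)
  interpret stiff_interval_space X I by (fact assms(1))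
  fix b c
  assume b: "b \<in> X - A" and c: "c \<in> X - A"
    and "set_between I A b c" and "set_between I A c b" and "b \<noteq> c"
  then obtain a a' where a: "a \<in> A" "I a b c" and a': "a' \<in> A" "I a' c b"
    by (auto simp: set_between_def)
  have X: "a \<in> X" "a' \<in> X" "b \<in> X" "c \<in> X"
    using a a' b c assms(2) by auto
  \<comment> \<open>Reversing the second triple makes it begin with the pair \<open>b\<close>,
    \<open>c\<close> that ends the first, as \<open>stiff\<close> requires.\<close>
  have "I b c a'"
    by (rule symm[OF X(2,4,3) a'(2)])
  then have "I a b a'"
    by (rule stiff[OF X(1,3,4,2) a(2) \<open>b \<noteq> c\<close>])
  then have "b \<in> A"
    using assms(3) X(1-3) a(1) a'(1) unfolding interval_convex_def by metis
  with b show False by simp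
qed

end
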